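(* Let $\Omega\subset\mathbb{R}^n$ be compact with nonempty interior, let $\lambda$ be a finite Borel measure on $\Omega$ with $\lambda(O)>0$ for some open set $O\subset\Omega$, and let $u\in L^2(\Omega,\lambda)$ be nonnegative. Let $(u^*_d)_{d\in\mathbb{N}}$ be a sequence of polynomials such that, for every $d\in\mathbb{N}$, $u^*_d$ is a minimizer of $$\min_{u_d\in\mathbb{R}[\mathbf{x}]_d}\ \|u-u_d\|_2^2=\int_\Omega(u-u_d)^2\,d\lambda .$$ Then $\|u-u^*_d\|_2\to 0$ as $d\to\infty$. In particular there is a subsequence $(d_k)_{k\in\mathbb{N}}$ such that $u^*_{d_k}\to u$ $\lambda$-almost everywhere and $\lambda$-almost uniformly on $\Omega$ as $k\to\infty$.
   Context: $\mathbb{R}[\mathbf{x}]_d$ is the space of real polynomials in $\mathbf{x}=(x_1,\dots,x_n)$ of degree at most $d$. $\|\cdot\|_2$ is the norm of $L^2(\Omega,\lambda)$. A sequence of functions $f_k$ converges to $f$ $\lambda$-almost uniformly on $\Omega$ if for every $\varepsilon>0$ there is a measurable set $A\subset\Omega$ with $\lambda(A)<\varepsilon$ such that $f_k\to f$ uniformly on $\Omega\setminus A$. *)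

theory Defs
  imports "HOL-Analysis.Analysis" "HOL-Library.Poly_Mapping"
begin

text \<open>
  Formal polynomials in finitely many variables indexed by \<^typ>\<open>'n\<close>, as finitely supported maps
  from monomials (finitely supported exponent vectors) to real coefficients.
\<close>

type_synonym 'n rpoly = "('n \<Rightarrow>\<^sub>0 nat) \<Rightarrow>\<^sub>0 real"

definition rpoly_eval :: "'n::finite rpoly \<Rightarrow> real ^ 'n \<Rightarrow> real" where
  "rpoly_eval p x =
     (\<Sum>m\<in>Poly_Mapping.keys p.
        Poly_Mapping.lookup p m * (\<Prod>i\<in>UNIV. (x $ i) ^ Poly_Mapping.lookup m i))"

definition rpolys_upto :: "nat \<Rightarrow> 'n::finite rpoly set" where
  "rpolys_upto d = {p. \<forall>m\<in>Poly_Mapping.keys p. (\<Sum>i\<in>UNIV. Poly_Mapping.lookup m i) \<le> d}"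

definition L2_space :: "'a measure \<Rightarrow> ('a \<Rightarrow> real) set" where
  "L2_space M = {f \<in> borel_measurable M. integrable M (\<lambda>x. (f x)\<^sup>2)}"

text \<open>The Bochner integral makes this value meaningful only for functions in \<^const>\<open>L2_space\<close>.\<close>

definition L2_norm_on :: "'a measure \<Rightarrow> ('a \<Rightarrow> real) \<Rightarrow> real" where
  "L2_norm_on M f = sqrt (\<integral>x. (f x)\<^sup>2 \<partial>M)"

definition almost_uniform_limit ::
    "'a measure \<Rightarrow> (nat \<Rightarrow> 'a \<Rightarrow> real) \<Rightarrow> ('a \<Rightarrow> real) \<Rightarrow> bool" where
  "almost_uniform_limit M f g \<longleftrightarrow>
     (\<forall>\<epsilon>>0. \<exists>A\<in>sets M. emeasure M A < ennreal \<epsilon> \<and> uniform_limit (space M - A) f g sequentially)"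

end

theory Submission
  imports Defs
begin

text \<open>
The squared distance from \<open>u\<close> to the polynomials of degree at most \<open>d\<close> decreases with \<open>d\<close>, and it
tends to zero as soon as the polynomials are dense in \<open>L\<^sup>2\<close>: one polynomial within \<open>\<epsilon>\<close> of \<open>u\<close>
competes against every minimizer of sufficiently high degree. So the analytic content of the
first claim is density, \<open>rpoly_dense_in_L2\<close>. By Stone--Weierstrass the polynomials approximate
every continuous function uniformly on the compact set \<open>\<Omega>\<close>, hence in mean square because the
measure is finite. Passing from continuous functions to all of \<open>L\<^sup>2\<close> uses a single tool,
\<open>L2_closure_dominated_limit\<close>: mean-square approximability survives dominated pointwise limits. It
gives indicators of closed sets as limits of continuous functions, then indicators of all Borel
sets by Dynkin's \<open>\<pi>\<close>-\<open>\<lambda>\<close> argument, then simple functions by linearity, and finally every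
square-integrable function as a limit of simple ones.

The second claim holds for every sequence that converges in mean square. Along a subsequence
whose squared errors are below \<open>8\<^sup>-\<^sup>k\<close>, Markov's inequality bounds the measure of the set where
the \<open>k\<close>-th error is at least \<open>2\<^sup>-\<^sup>k\<close> by \<open>2\<^sup>-\<^sup>k\<close>. These bounds are summable, so removing a tail of
these sets leaves uniform convergence (\<open>almost_uniform_limit_if_square_integrals_small\<close>), and
almost uniform convergence implies convergence almost everywhere.
\<close>

section \<open>Square-integrable functions\<close>

lemma square_sum_le: "(a + b)\<^sup>2 \<le> 2 * a\<^sup>2 + 2 * b\<^sup>2" for a b :: real
  using zero_le_power2[of "a - b"] by (simp add: power2_sum power2_diff)

lemma L2_space_dominated:
  assumes f: "f \<in> borel_measurable M" and w: "integrable M w"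
    and le: "\<And>x. x \<in> space M \<Longrightarrow> (f x)\<^sup>2 \<le> w x"
  shows "f \<in> L2_space M"
proof -
  have "integrable M (\<lambda>x. (f x)\<^sup>2)"
    by (rule Bochner_Integration.integrable_bound[OF w])
      (use f le in \<open>auto intro!: AE_I2 order_trans[OF _ abs_ge_self]\<close>)
  then show ?thesis
    using f by (simp add: L2_space_def)
qed

lemma L2_space_add:
  assumes "f \<in> L2_space M" "g \<in> L2_space M"
  shows "(\<lambda>x. f x + g x) \<in> L2_space M"
proof (rule L2_space_dominated)
  show "integrable M (\<lambda>x. 2 * (f x)\<^sup>2 + 2 * (g x)\<^sup>2)"
    using assms by (simp add: L2_space_def)
qed (use assms in \<open>auto simp: L2_space_def square_sum_le\<close>)

lemma L2_space_scale:
  assumes "f \<in> L2_space M"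
  shows "(\<lambda>x. c * f x) \<in> L2_space M"
  using assms by (auto simp: L2_space_def power_mult_distrib)

lemma L2_space_diff:
  assumes "f \<in> L2_space M" "g \<in> L2_space M"
  shows "(\<lambda>x. f x - g x) \<in> L2_space M"
  using L2_space_add[OF assms(1) L2_space_scale[OF assms(2), of "-1"]] by simp

lemma L2_space_bounded:
  assumes "finite_measure M" "f \<in> borel_measurable M"
    and "\<And>x. x \<in> space M \<Longrightarrow> \<bar>f x\<bar> \<le> B"
  shows "f \<in> L2_space M"
proof (rule L2_space_dominated)
  show "integrable M (\<lambda>x. B\<^sup>2)"
    using assms(1) by (simp add: finite_measure.integrable_const)
  show "(f x)\<^sup>2 \<le> B\<^sup>2" if "x \<in> space M" for x
    using assms(3)[OF that] by (simp add: abs_le_square_iff[symmetric])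
qed fact

lemma L2_space_indicator:
  assumes "finite_measure M" "A \<in> sets M"
  shows "indicat_real A \<in> L2_space M"
  using assms by (intro L2_space_bounded[where B = 1]) (auto simp: indicator_def)

text \<open>
The factor 2 makes this weaker than Minkowski's inequality, but it needs no square roots and
suffices wherever only the smallness of squared distances matters.
\<close>

lemma integral_square_add_le:
  assumes "f \<in> L2_space M" "g \<in> L2_space M"
  shows "(\<integral>x. (f x + g x)\<^sup>2 \<partial>M) \<le> 2 * (\<integral>x. (f x)\<^sup>2 \<partial>M) + 2 * (\<integral>x. (g x)\<^sup>2 \<partial>M)"
proof -
  have "(\<integral>x. (f x + g x)\<^sup>2 \<partial>M) \<le> (\<integral>x. 2 * (f x)\<^sup>2 + 2 * (g x)\<^sup>2 \<partial>M)"
    using assms L2_space_add[OF assms]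
    by (intro integral_mono) (auto simp: L2_space_def square_sum_le)
  also have "\<dots> = 2 * (\<integral>x. (f x)\<^sup>2 \<partial>M) + 2 * (\<integral>x. (g x)\<^sup>2 \<partial>M)"
    using assms by (simp add: L2_space_def)
  finally show ?thesis .
qed

section \<open>Closures in the mean-square sense\<close>

text \<open>
The squared distance is used throughout, which avoids square roots. The elements are functions and
not classes modulo null sets, so that pointwise limits can be taken directly.
\<close>

definition L2_closure :: "'a measure \<Rightarrow> ('a \<Rightarrow> real) set \<Rightarrow> ('a \<Rightarrow> real) set" where
  "L2_closure M V =
     {f \<in> L2_space M. \<forall>e>0. \<exists>g\<in>V. (\<integral>x. (f x - g x)\<^sup>2 \<partial>M) < e}"

lemma L2_closure_in_L2: "f \<in> L2_closure M V \<Longrightarrow> f \<in> L2_space M"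
  by (simp add: L2_closure_def)

lemma subset_L2_closure:
  assumes "V \<subseteq> L2_space M"
  shows "V \<subseteq> L2_closure M V"
proof
  fix f assume "f \<in> V"
  then show "f \<in> L2_closure M V"
    using assms by (auto simp: L2_closure_def intro: bexI[of _ f])
qed

lemma L2_closure_closed:
  assumes V: "V \<subseteq> L2_space M" and f: "f \<in> L2_space M"
    and approx: "\<And>e. e > 0 \<Longrightarrow> \<exists>h\<in>L2_closure M V. (\<integral>x. (f x - h x)\<^sup>2 \<partial>M) < e"
  shows "f \<in> L2_closure M V"
  unfolding L2_closure_def
proof (intro CollectI conjI allI impI f)
  fix e :: real
  assume e: "e > 0"
  obtain h where h: "h \<in> L2_closure M V" and fh: "(\<integral>x. (f x - h x)\<^sup>2 \<partial>M) < e / 4"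
    using approx[of "e / 4"] e by auto
  obtain g where g: "g \<in> V" and hg: "(\<integral>x. (h x - g x)\<^sup>2 \<partial>M) < e / 4"
    using h e unfolding L2_closure_def by (fastforce dest: spec[of _ "e / 4"])
  have "(\<integral>x. (f x - g x)\<^sup>2 \<partial>M) = (\<integral>x. ((f x - h x) + (h x - g x))\<^sup>2 \<partial>M)"
    by simp
  also have "\<dots> \<le> 2 * (\<integral>x. (f x - h x)\<^sup>2 \<partial>M) + 2 * (\<integral>x. (h x - g x)\<^sup>2 \<partial>M)"
    using V g f L2_closure_in_L2[OF h] by (intro integral_square_add_le L2_space_diff) auto
  also have "\<dots> < e"
    using fh hg by simp
  finally show "\<exists>g\<in>V. (\<integral>x. (f x - g x)\<^sup>2 \<partial>M) < e"
    using g by blast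
qed

lemma L2_closure_add:
  assumes V: "V \<subseteq> L2_space M" and V_add: "\<And>f g. f \<in> V \<Longrightarrow> g \<in> V \<Longrightarrow> (\<lambda>x. f x + g x) \<in> V"
    and f: "f \<in> L2_closure M V" and f': "f' \<in> L2_closure M V"
  shows "(\<lambda>x. f x + f' x) \<in> L2_closure M V"
  unfolding L2_closure_def
proof (intro CollectI conjI allI impI)
  show "(\<lambda>x. f x + f' x) \<in> L2_space M"
    using f f' by (intro L2_space_add L2_closure_in_L2)
  fix e :: real
  assume e: "e > 0"
  obtain g where g: "g \<in> V" "(\<integral>x. (f x - g x)\<^sup>2 \<partial>M) < e / 4"
    using f e unfolding L2_closure_def by (fastforce dest: spec[of _ "e / 4"])
  obtain g' where g': "g' \<in> V" "(\<integral>x. (f' x - g' x)\<^sup>2 \<partial>M) < e / 4"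
    using f' e unfolding L2_closure_def by (fastforce dest: spec[of _ "e / 4"])
  have "(\<integral>x. ((f x + f' x) - (g x + g' x))\<^sup>2 \<partial>M)
      = (\<integral>x. ((f x - g x) + (f' x - g' x))\<^sup>2 \<partial>M)"
    by (simp add: algebra_simps)
  also have "\<dots> \<le> 2 * (\<integral>x. (f x - g x)\<^sup>2 \<partial>M) + 2 * (\<integral>x. (f' x - g' x)\<^sup>2 \<partial>M)"
    using V g(1) g'(1) L2_closure_in_L2[OF f] L2_closure_in_L2[OF f']
    by (intro integral_square_add_le L2_space_diff) auto
  also have "\<dots> < e"
    using g(2) g'(2) by simp
  finally show "\<exists>g\<in>V. (\<integral>x. (f x + f' x - g x)\<^sup>2 \<partial>M) < e"
    using V_add[OF g(1) g'(1)] by (intro bexI[where x = "\<lambda>x. g x + g' x"])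
qed

lemma L2_closure_scale:
  assumes V_scale: "\<And>f c. f \<in> V \<Longrightarrow> (\<lambda>x. c * f x) \<in> V"
    and f: "f \<in> L2_closure M V"
  shows "(\<lambda>x. c * f x) \<in> L2_closure M V"
  unfolding L2_closure_def
proof (intro CollectI conjI allI impI)
  show "(\<lambda>x. c * f x) \<in> L2_space M"
    using f by (intro L2_space_scale L2_closure_in_L2)
  fix e :: real
  assume e: "e > 0"
  \<comment> \<open>The summand 1 lets one bound cover the case c = 0.\<close>
  have "e / (c\<^sup>2 + 1) > 0"
    using e by (simp add: add_nonneg_pos)
  then obtain g where g: "g \<in> V" "(\<integral>x. (f x - g x)\<^sup>2 \<partial>M) < e / (c\<^sup>2 + 1)"
    using f unfolding L2_closure_def by blast
  have "(\<integral>x. (c * f x - c * g x)\<^sup>2 \<partial>M) = c\<^sup>2 * (\<integral>x. (f x - g x)\<^sup>2 \<partial>M)"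
    by (simp add: right_diff_distrib[symmetric] power_mult_distrib)
  also have "\<dots> \<le> (c\<^sup>2 + 1) * (\<integral>x. (f x - g x)\<^sup>2 \<partial>M)"
    by (intro mult_right_mono integral_nonneg_AE) auto
  also have "\<dots> < e"
    using g(2) by (simp add: pos_less_divide_eq add_nonneg_pos mult.commute)
  finally show "\<exists>g\<in>V. (\<integral>x. (c * f x - g x)\<^sup>2 \<partial>M) < e"
    using V_scale[OF g(1)] by (intro bexI[where x = "\<lambda>x. c * g x"])
qed

text \<open>
Dominated convergence, applied to \<open>(f - s i)\<^sup>2 \<le> 4 w\<^sup>2\<close>, turns pointwise into mean-square
convergence, and the closure is closed. All passages to a limit on the way from continuous to
square-integrable functions are instances.
\<close>

lemma L2_closure_dominated_limit:
  assumes V: "V \<subseteq> L2_space M" and s: "\<And>i. s i \<in> L2_closure M V" and w: "w \<in> L2_space M"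
    and bound: "\<And>i x. x \<in> space M \<Longrightarrow> \<bar>s i x\<bar> \<le> w x"
    and lim: "\<And>x. x \<in> space M \<Longrightarrow> (\<lambda>i. s i x) \<longlonglongrightarrow> f x"
  shows "f \<in> L2_closure M V"
proof -
  have s_meas [measurable]: "s i \<in> borel_measurable M" for i
    using L2_closure_in_L2[OF s] by (simp add: L2_space_def)
  have f_meas [measurable]: "f \<in> borel_measurable M"
    by (rule borel_measurable_LIMSEQ_real[OF lim s_meas])
  have int_w: "integrable M (\<lambda>x. (w x)\<^sup>2)"
    using w by (simp add: L2_space_def)
  have f_bound: "\<bar>f x\<bar> \<le> w x" if "x \<in> space M" for x
    by (rule LIMSEQ_le_const2[OF tendsto_rabs[OF lim[OF that]]]) (use bound that in auto)
  have f_L2: "f \<in> L2_space M"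
  proof (rule L2_space_dominated[OF f_meas int_w])
    show "(f x)\<^sup>2 \<le> (w x)\<^sup>2" if "x \<in> space M" for x
      using f_bound[OF that] by (simp add: abs_le_square_iff[symmetric])
  qed
  have "(\<lambda>i. \<integral>x. (f x - s i x)\<^sup>2 \<partial>M) \<longlonglongrightarrow> (\<integral>x. 0 \<partial>M)"
  proof (rule integral_dominated_convergence[where w = "\<lambda>x. 4 * (w x)\<^sup>2"])
    show "AE x in M. (\<lambda>i. (f x - s i x)\<^sup>2) \<longlonglongrightarrow> 0"
    proof (rule AE_I2)
      fix x assume "x \<in> space M"
      then have "(\<lambda>i. (f x - s i x)\<^sup>2) \<longlonglongrightarrow> (f x - f x)\<^sup>2"
        by (intro tendsto_intros lim)
      then show "(\<lambda>i. (f x - s i x)\<^sup>2) \<longlonglongrightarrow> 0" by simp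
    qed
    show "AE x in M. norm ((f x - s i x)\<^sup>2) \<le> 4 * (w x)\<^sup>2" for i
    proof (rule AE_I2)
      fix x assume "x \<in> space M"
      then have "\<bar>f x - s i x\<bar> \<le> \<bar>2 * w x\<bar>"
        using f_bound[of x] bound[of x i] by linarith
      then show "norm ((f x - s i x)\<^sup>2) \<le> 4 * (w x)\<^sup>2"
        by (simp add: abs_le_square_iff power_mult_distrib)
    qed
  qed (use int_w in auto)
  then have lim0: "(\<lambda>i. \<integral>x. (f x - s i x)\<^sup>2 \<partial>M) \<longlonglongrightarrow> 0" by simp
  show ?thesis
  proof (rule L2_closure_closed[OF V f_L2])
    fix e :: real assume "e > 0"
    then obtain i where "(\<integral>x. (f x - s i x)\<^sup>2 \<partial>M) < e"
      using order_tendstoD(2)[OF lim0] by (auto simp: eventually_sequentially)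
    then show "\<exists>h\<in>L2_closure M V. (\<integral>x. (f x - h x)\<^sup>2 \<partial>M) < e"
      using s by blast
  qed
qed

text \<open>
A square-integrable \<open>f\<close> is the pointwise limit of simple functions bounded by \<open>2 \<bar>f\<bar>\<close>, and simple
functions are linear combinations of indicators.
\<close>

lemma L2_space_subset_closure_if_indicators:
  assumes "finite_measure M" and V: "V \<subseteq> L2_space M"
    and V_add: "\<And>f g. f \<in> V \<Longrightarrow> g \<in> V \<Longrightarrow> (\<lambda>x. f x + g x) \<in> V"
    and V_scale: "\<And>f c. f \<in> V \<Longrightarrow> (\<lambda>x. c * f x) \<in> V"
    and ind: "\<And>A. A \<in> sets M \<Longrightarrow> indicat_real A \<in> L2_closure M V"
  shows "L2_space M \<subseteq> L2_closure M V"
proof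
  interpret finite_measure M by fact
  have finite_support: "emeasure M {x \<in> space M. s x \<noteq> 0} \<noteq> \<infinity>" for s :: "'a \<Rightarrow> real"
    by simp
  have simple: "s \<in> L2_closure M V" if "simple_function M s" for s :: "'a \<Rightarrow> real"
    using that finite_support[of s]
  proof (induction rule: integrable_simple_function_induct)
    case (cong f g)
    then show ?case
      using L2_closure_in_L2[OF cong(6)]
      by (intro L2_closure_dominated_limit[OF V, of "\<lambda>_. f" "\<lambda>x. \<bar>f x\<bar>" g])
        (auto simp: L2_space_def)
  next
    case (indicator A y)
    then show ?case
      using L2_closure_scale[OF V_scale ind, of A y] by (simp add: mult.commute)
  next
    case (add f g)
    then show ?case
      by (intro L2_closure_add[OF V V_add])
  qed
  fix f assume f: "f \<in> L2_space M"
  then have "f \<in> borel_measurable M" by (simp add: L2_space_def)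
  then obtain s where s: "\<And>i. simple_function M (s i)"
    "\<And>x. x \<in> space M \<Longrightarrow> (\<lambda>i. s i x) \<longlonglongrightarrow> f x"
    "\<And>i x. x \<in> space M \<Longrightarrow> dist (s i x) 0 \<le> 2 * dist (f x) 0"
    by (metis borel_measurable_implies_sequence_metric)
  have "(\<lambda>x. \<bar>f x\<bar>) \<in> L2_space M"
    using f by (auto simp: L2_space_def)
  then have w: "(\<lambda>x. 2 * \<bar>f x\<bar>) \<in> L2_space M"
    by (rule L2_space_scale)
  show "f \<in> L2_closure M V"
    using L2_closure_dominated_limit[OF V simple[OF s(1)] w _ s(2)] s(3) by auto
qed

section \<open>Density of continuous functions\<close>

text \<open>
Since \<open>C\<close> is closed, a point outside it has positive distance to it, so the ramps
\<open>max 0 (1 - n d(x, C))\<close> vanish there from some \<open>n\<close> on. They are equal to 1 on \<open>C\<close>. The case of an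
empty \<open>C\<close> is excluded because \<open>infdist x {}\<close> is 0 by convention.
\<close>

lemma indicator_closed_limit:
  fixes C :: "'a::metric_space set"
  assumes "closed C" "C \<noteq> {}"
  shows "(\<lambda>n. max 0 (1 - real n * infdist x C)) \<longlonglongrightarrow> indicat_real C x"
proof (cases "x \<in> C")
  case True
  then show ?thesis by simp
next
  case False
  then have pos: "infdist x C > 0"
    using assms in_closed_iff_infdist_zero[of C x] infdist_nonneg[of x C] by linarith
  then obtain N where N: "real N * infdist x C > 1"
    using reals_Archimedean3 by blast
  have "eventually (\<lambda>n. max 0 (1 - real n * infdist x C) = 0) sequentially"
    using eventually_ge_at_top[of N]
  proof eventually_elim
    case (elim n)
    have "real N * infdist x C \<le> real n * infdist x C"
      using elim pos by (intro mult_right_mono) auto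
    then show ?case using N by simp
  qed
  then show ?thesis
    using False by (simp add: tendsto_eventually)
qed

lemma space_eq_if_sets_eq_restrict_borel:
  assumes "sets M = sets (restrict_space borel \<Omega>)"
  shows "space M = \<Omega>"
  using sets_eq_imp_space_eq[OF assms] by (simp add: space_restrict_space)

lemma measurable_of_continuous_on:
  assumes "sets M = sets (restrict_space borel \<Omega>)" "continuous_on \<Omega> f"
  shows "f \<in> borel_measurable M"
  using borel_measurable_continuous_on_restrict[OF assms(2)]
    measurable_cong_sets[OF assms(1) refl] by blast

text \<open>
The sets with approximable indicator contain the closed sets, which generate the Borel sets and
are stable under intersection, and they form a Dynkin system: complements and disjoint unions
become \<open>1 - f\<close> and series of indicators whose partial sums are bounded by 1. The constant 1 is in
the closure, and hence an admissible dominating function, because it is continuous.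
\<close>

lemma L2_closure_indicator_borel:
  fixes \<Omega> :: "'a::metric_space set"
  assumes V: "V \<subseteq> L2_space M"
    and V_add: "\<And>f g. f \<in> V \<Longrightarrow> g \<in> V \<Longrightarrow> (\<lambda>x. f x + g x) \<in> V"
    and V_scale: "\<And>f c. f \<in> V \<Longrightarrow> (\<lambda>x. c * f x) \<in> V"
    and cont: "\<And>f. continuous_on \<Omega> f \<Longrightarrow> f \<in> L2_closure M V"
    and B: "B \<in> sets borel"
  shows "indicat_real B \<in> L2_closure M V"
proof -
  have one: "(\<lambda>x. 1) \<in> L2_closure M V"
    by (intro cont continuous_on_const)
  then have one_L2: "(\<lambda>x. 1) \<in> L2_space M"
    by (rule L2_closure_in_L2)
  have "Int_stable (Collect closed :: 'a set set)"
    by (auto simp: Int_stable_def)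
  moreover have "Collect closed \<subseteq> Pow (UNIV :: 'a set)"
    by simp
  moreover have "B \<in> sigma_sets UNIV (Collect closed)"
    using B by (simp add: borel_eq_closed)
  ultimately show ?thesis
  proof (induction rule: sigma_sets_induct_disjoint)
    case (basic C)
    show ?case
    proof (cases "C = {}")
      case True
      then show ?thesis using cont[of "\<lambda>x. 0"] by simp
    next
      case False
      show ?thesis
      proof (rule L2_closure_dominated_limit[OF V _ one_L2])
        show "(\<lambda>x. max 0 (1 - real n * infdist x C)) \<in> L2_closure M V" for n
          by (intro cont continuous_intros)
        show "\<bar>max 0 (1 - real n * infdist x C)\<bar> \<le> 1" for n x
          by (simp add: infdist_nonneg)
        show "(\<lambda>n. max 0 (1 - real n * infdist x C)) \<longlonglongrightarrow> indicat_real C x" for x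
          using basic False by (intro indicator_closed_limit) auto
      qed
    qed
  next
    case empty
    then show ?case using cont[of "\<lambda>x. 0"] by simp
  next
    case (compl A)
    have "indicat_real (UNIV - A) = (\<lambda>x. 1 + (-1) * indicat_real A x)"
      by (auto simp: indicator_def)
    moreover have "(\<lambda>x. 1 + (-1) * indicat_real A x) \<in> L2_closure M V"
      by (rule L2_closure_add[OF V V_add one L2_closure_scale[OF V_scale compl(2)]])
    ultimately show ?case by (simp only:)
  next
    case (union A)
    have partial: "(\<lambda>x. \<Sum>i<n. indicat_real (A i) x) \<in> L2_closure M V" for n
    proof (induction n)
      case 0
      then show ?case using cont[of "\<lambda>x. 0"] by simp
    next
      case (Suc n)
      have "(\<lambda>x. (\<Sum>i<n. indicat_real (A i) x) + indicat_real (A n) x) \<in> L2_closure M V"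
        by (rule L2_closure_add[OF V V_add Suc union(3)[of n]])
      then show ?case by (simp only: sum.lessThan_Suc)
    qed
    show ?case
    proof (rule L2_closure_dominated_limit[OF V _ one_L2])
      show "indicat_real (\<Union>i<n. A i) \<in> L2_closure M V" for n
      proof -
        have "disjoint_family_on A {..<n}"
          using union(1) by (rule disjoint_family_on_mono[OF subset_UNIV])
        then have "indicat_real (\<Union>i<n. A i) = (\<lambda>x. \<Sum>i<n. indicat_real (A i) x)"
          by (intro ext indicator_UN_disjoint) auto
        then show ?thesis using partial[of n] by simp
      qed
      show "(\<lambda>n. indicat_real (\<Union>i<n. A i) x) \<longlonglongrightarrow> indicat_real (\<Union>i. A i) x" for x
        by (rule LIMSEQ_indicator_UN)
    qed (auto simp: indicator_def)
  qed
qed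

text \<open>
The measurable sets of \<open>M\<close> are the traces on \<open>\<Omega>\<close> of Borel sets of the ambient space, and the
indicators of a set and of its trace agree on \<open>\<Omega>\<close>.
\<close>

lemma L2_space_subset_closure_if_continuous:
  fixes \<Omega> :: "'a::metric_space set"
  assumes fin: "finite_measure M" and sets_M: "sets M = sets (restrict_space borel \<Omega>)"
    and V: "V \<subseteq> L2_space M"
    and V_add: "\<And>f g. f \<in> V \<Longrightarrow> g \<in> V \<Longrightarrow> (\<lambda>x. f x + g x) \<in> V"
    and V_scale: "\<And>f c. f \<in> V \<Longrightarrow> (\<lambda>x. c * f x) \<in> V"
    and cont: "\<And>f. continuous_on \<Omega> f \<Longrightarrow> f \<in> L2_closure M V"
  shows "L2_space M \<subseteq> L2_closure M V"
proof (rule L2_space_subset_closure_if_indicators[OF fin V V_add V_scale])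
  fix A assume A: "A \<in> sets M"
  note space_M = space_eq_if_sets_eq_restrict_borel[OF sets_M]
  obtain B where B: "B \<in> sets borel" "A = \<Omega> \<inter> B"
    using A sets_M by (auto simp: sets_restrict_space)
  have B_cl: "indicat_real B \<in> L2_closure M V"
    by (rule L2_closure_indicator_borel[OF V V_add V_scale cont B(1)])
  show "indicat_real A \<in> L2_closure M V"
    by (rule L2_closure_dominated_limit[OF V B_cl L2_closure_in_L2[OF B_cl]])
      (auto simp: B(2) space_M indicator_def)
qed

section \<open>Density of polynomials\<close>

lemma rpoly_eval_add: "rpoly_eval (p + q) x = rpoly_eval p x + rpoly_eval q x"
  unfolding rpoly_eval_def
  by (rule setsum_keys_plus_distrib) (simp_all add: distrib_right)

lemma rpoly_eval_single:
  "rpoly_eval (Poly_Mapping.single m c) x = c * (\<Prod>i\<in>UNIV. (x $ i) ^ Poly_Mapping.lookup m i)"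
  by (simp add: rpoly_eval_def)

lemma rpoly_eval_const: "rpoly_eval (Poly_Mapping.single 0 c) x = c"
  by (simp add: rpoly_eval_single)

lemma rpoly_eval_coordinate:
  "rpoly_eval (Poly_Mapping.single (Poly_Mapping.single j 1) 1) x = x $ j"
proof -
  have "(\<Prod>i\<in>UNIV. (x $ i) ^ Poly_Mapping.lookup (Poly_Mapping.single j 1) i)
      = (\<Prod>i\<in>UNIV. if i = j then x $ i else 1)"
    by (intro prod.cong) (auto simp: lookup_single when_def)
  then show ?thesis by (simp add: rpoly_eval_single)
qed

text \<open>
Induction over the monomials, in a form that fits the additivity of evaluation.
\<close>

lemma rpoly_induct [case_names zero add]:
  fixes p :: "'n::finite rpoly"
  assumes "P 0" and "\<And>m c q. P q \<Longrightarrow> P (q + Poly_Mapping.single m c)"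
  shows "P p"
proof (induction p rule: update_induct)
  case const
  show ?case by fact
next
  case (update q m c)
  have "Poly_Mapping.update m c q = q + Poly_Mapping.single m c"
    using update(1)
    by (intro poly_mapping_eqI)
      (auto simp: lookup_update lookup_add lookup_single when_def in_keys_iff)
  then show ?case using assms(2)[OF update(3)] by simp
qed

text \<open>
Both sides are biadditive in \<open>p\<close> and \<open>q\<close>, so the claim reduces to products of two monomials,
whose exponents add.
\<close>

lemma rpoly_eval_mult: "rpoly_eval (p * q) x = rpoly_eval p x * rpoly_eval q x"
proof (induction p rule: rpoly_induct)
  case zero
  then show ?case by (simp add: rpoly_eval_def)
next
  case (add m c p)
  have "rpoly_eval (Poly_Mapping.single m c * q) x
      = rpoly_eval (Poly_Mapping.single m c) x * rpoly_eval q x"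
  proof (induction q rule: rpoly_induct)
    case zero
    then show ?case by (simp add: rpoly_eval_def)
  next
    case (add m' c' q)
    then show ?case
      by (simp add: distrib_left rpoly_eval_add mult_single rpoly_eval_single lookup_add
          power_add prod.distrib)
  qed
  with add show ?case
    by (simp add: distrib_right rpoly_eval_add)
qed

lemma continuous_on_rpoly_eval: "continuous_on S (rpoly_eval p)"
  unfolding rpoly_eval_def by (intro continuous_intros)

text \<open>
Stone--Weierstrass: polynomial functions form an algebra that contains the constants and, by its
coordinate functions, separates points.
\<close>

lemma rpoly_uniform_approximation:
  fixes f :: "real ^ 'n \<Rightarrow> real"
  assumes "compact \<Omega>" "continuous_on \<Omega> f" "e > 0"
  shows "\<exists>p. \<forall>x\<in>\<Omega>. \<bar>f x - rpoly_eval p x\<bar> < e"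
proof -
  have "\<exists>g. g \<in> range rpoly_eval \<and> (\<forall>x\<in>\<Omega>. \<bar>f x - g x\<bar> < e)"
  proof (rule Stone_Weierstrass_HOL[OF assms(1) _ _ _ _ _ assms(2,3)])
    show "(\<lambda>x. c) \<in> range rpoly_eval" for c :: real
      by (rule range_eqI[of _ _ "Poly_Mapping.single 0 c"]) (simp add: fun_eq_iff rpoly_eval_const)
    show "continuous_on \<Omega> g" if "g \<in> range rpoly_eval" for g
      using that continuous_on_rpoly_eval by blast
    fix g h :: "real ^ 'n \<Rightarrow> real"
    assume "g \<in> range rpoly_eval \<and> h \<in> range rpoly_eval"
    then obtain p q where pq: "g = rpoly_eval p" "h = rpoly_eval q" by blast
    show "(\<lambda>x. g x + h x) \<in> range rpoly_eval"
      by (rule range_eqI[of _ _ "p + q"]) (simp add: fun_eq_iff rpoly_eval_add pq)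
    show "(\<lambda>x. g x * h x) \<in> range rpoly_eval"
      by (rule range_eqI[of _ _ "p * q"]) (simp add: fun_eq_iff rpoly_eval_mult pq)
  next
    fix x y :: "real ^ 'n"
    assume "x \<in> \<Omega> \<and> y \<in> \<Omega> \<and> x \<noteq> y"
    then obtain j where "x $ j \<noteq> y $ j" by (auto simp: vec_eq_iff)
    then have "rpoly_eval (Poly_Mapping.single (Poly_Mapping.single j 1) 1) x
        \<noteq> rpoly_eval (Poly_Mapping.single (Poly_Mapping.single j 1) 1) y"
      unfolding rpoly_eval_coordinate .
    then show "\<exists>f. f \<in> range rpoly_eval \<and> f x \<noteq> f y" by blast
  qed
  then show ?thesis by blast
qed

lemma L2_space_continuous_on_compact:
  fixes \<Omega> :: "'a::metric_space set" and f :: "'a \<Rightarrow> real"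
  assumes "compact \<Omega>" "finite_measure M" "sets M = sets (restrict_space borel \<Omega>)"
    and "continuous_on \<Omega> f"
  shows "f \<in> L2_space M"
proof -
  note space_M = space_eq_if_sets_eq_restrict_borel[OF assms(3)]
  have "bounded (f ` \<Omega>)"
    by (intro compact_imp_bounded compact_continuous_image assms)
  then obtain B where "\<And>x. x \<in> \<Omega> \<Longrightarrow> \<bar>f x\<bar> \<le> B"
    by (auto simp: bounded_iff)
  then show ?thesis
    using assms by (intro L2_space_bounded[where B = B] measurable_of_continuous_on)
      (auto simp: space_M)
qed

text \<open>
What remains is to put continuous functions into the closure of the polynomials.
Uniform approximations \<open>p k\<close> of \<open>f\<close> with error below \<open>1 / (k + 1)\<close> converge pointwise to \<open>f\<close> on
\<open>\<Omega>\<close> and are dominated by \<open>\<bar>f\<bar> + 1\<close>.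
\<close>

proposition rpoly_dense_in_L2:
  fixes \<Omega> :: "(real ^ 'n) set"
  assumes comp: "compact \<Omega>" and fin: "finite_measure M"
    and sets_M: "sets M = sets (restrict_space borel \<Omega>)"
    and u: "u \<in> L2_space M" and e: "e > 0"
  obtains p where "(\<integral>x. (u x - rpoly_eval p x)\<^sup>2 \<partial>M) < e"
proof -
  let ?V = "range rpoly_eval :: (real ^ 'n \<Rightarrow> real) set"
  note cont_L2 = L2_space_continuous_on_compact[OF comp fin sets_M]
  note space_M = space_eq_if_sets_eq_restrict_borel[OF sets_M]
  have V: "?V \<subseteq> L2_space M"
    using cont_L2 continuous_on_rpoly_eval by blast
  have "L2_space M \<subseteq> L2_closure M ?V"
  proof (rule L2_space_subset_closure_if_continuous[OF fin sets_M V])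
    fix g h :: "real ^ 'n \<Rightarrow> real" and c
    assume "g \<in> ?V"
    then obtain p where p: "g = rpoly_eval p" by blast
    show "(\<lambda>x. c * g x) \<in> ?V"
      by (rule range_eqI[of _ _ "Poly_Mapping.single 0 c * p"])
        (simp add: fun_eq_iff rpoly_eval_mult rpoly_eval_const p)
    assume "h \<in> ?V"
    then obtain q where q: "h = rpoly_eval q" by blast
    show "(\<lambda>x. g x + h x) \<in> ?V"
      by (rule range_eqI[of _ _ "p + q"]) (simp add: fun_eq_iff rpoly_eval_add p q)
  next
    fix f :: "real ^ 'n \<Rightarrow> real"
    assume f: "continuous_on \<Omega> f"
    have "\<exists>p. \<forall>x\<in>\<Omega>. \<bar>f x - rpoly_eval p x\<bar> < 1 / real (Suc k)" for k
      by (rule rpoly_uniform_approximation[OF comp f]) simp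
    then obtain p where p: "\<And>k x. x \<in> \<Omega> \<Longrightarrow> \<bar>f x - rpoly_eval (p k) x\<bar> < 1 / real (Suc k)"
      by metis
    show "f \<in> L2_closure M ?V"
    proof (rule L2_closure_dominated_limit[OF V])
      show "rpoly_eval (p k) \<in> L2_closure M ?V" for k
        using subset_L2_closure[OF V] by blast
      show "(\<lambda>x. \<bar>f x\<bar> + 1) \<in> L2_space M"
        by (intro cont_L2 continuous_intros f)
      fix x assume x: "x \<in> space M"
      show "\<bar>rpoly_eval (p k) x\<bar> \<le> \<bar>f x\<bar> + 1" for k
      proof -
        have "\<bar>f x - rpoly_eval (p k) x\<bar> < 1 / real (Suc k)"
          using p x space_M by blast
        also have "\<dots> \<le> 1" by simp
        finally show ?thesis by linarith
      qed
      have "(\<lambda>k. rpoly_eval (p k) x - f x) \<longlonglongrightarrow> 0"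
        using p[of x] x space_M
        by (intro Lim_null_comparison[OF always_eventually lim_1_over_n[THEN LIMSEQ_Suc]])
          (auto simp: abs_minus_commute less_imp_le)
      then show "(\<lambda>k. rpoly_eval (p k) x) \<longlonglongrightarrow> f x"
        by (simp add: LIM_zero_iff)
    qed
  qed
  with u e show thesis
    using that by (fastforce simp: L2_closure_def)
qed

section \<open>Almost uniform convergence\<close>

text \<open>
A point of divergence lies in every exceptional set, and the exceptional sets can be chosen with
arbitrarily small measure.
\<close>

lemma almost_uniform_limit_imp_AE:
  assumes "almost_uniform_limit M f g"
  shows "AE x in M. (\<lambda>k. f k x) \<longlonglongrightarrow> g x"
proof -
  have "\<exists>A\<in>sets M. emeasure M A < ennreal (1 / real (Suc n)) \<and>
      uniform_limit (space M - A) f g sequentially" for n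
    using assms by (auto simp: almost_uniform_limit_def)
  then obtain A where A: "\<And>n. A n \<in> sets M" "\<And>n. emeasure M (A n) < ennreal (1 / real (Suc n))"
    "\<And>n. uniform_limit (space M - A n) f g sequentially"
    by metis
  show ?thesis
  proof (rule AE_I)
    show "{x \<in> space M. \<not> (\<lambda>k. f k x) \<longlonglongrightarrow> g x} \<subseteq> (\<Inter>n. A n)"
      using tendsto_uniform_limitI[OF A(3)] by blast
    show "(\<Inter>n. A n) \<in> sets M"
      using A(1) by blast
    have "emeasure M (\<Inter>n. A n) \<le> ennreal (1 / real (Suc n))" for n
      using order_trans[OF emeasure_mono less_imp_le[OF A(2)]] A(1) by blast
    moreover have "(\<lambda>n. ennreal (1 / real (Suc n))) \<longlonglongrightarrow> ennreal 0"
      using tendsto_ennrealI[OF LIMSEQ_Suc[OF lim_1_over_n[where 'a = real]]] by simp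
    ultimately have "emeasure M (\<Inter>n. A n) \<le> ennreal 0"
      by (intro LIMSEQ_le_const) auto
    then show "emeasure M (\<Inter>n. A n) = 0" by simp
  qed
qed

lemma fast_subsequence:
  fixes J :: "nat \<Rightarrow> real"
  assumes "J \<longlonglongrightarrow> 0" and "\<And>k. b k > 0"
  obtains r :: "nat \<Rightarrow> nat" where "strict_mono r" "\<And>k. J (r k) < b k"
proof -
  have "\<exists>m. J m < b k \<and> m > n" for k n
  proof -
    have "eventually (\<lambda>m. J m < b k \<and> m > n) sequentially"
      using order_tendstoD(2)[OF assms(1,2)] eventually_gt_at_top by (rule eventually_conj)
    then show ?thesis
      using eventually_happens' sequentially_bot by blast
  qed
  then have "\<exists>r. \<forall>k. J (r k) < b k \<and> r k < r (Suc k)"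
    by (intro dependent_nat_choice) blast+
  then obtain r where r: "\<And>k. J (r k) < b k" "\<And>k. r k < r (Suc k)"
    by blast
  show thesis
  proof (rule that)
    show "strict_mono r"
      using r(2) by (rule strict_monoI_Suc)
  qed (rule r(1))
qed

text \<open>
A Borel--Cantelli argument with uniform rates. Markov's inequality for the squared error with
threshold \<open>4\<^sup>-\<^sup>k\<close> bounds the measure of the bad set \<open>B k\<close> by \<open>4\<^sup>k 8\<^sup>-\<^sup>k = 2\<^sup>-\<^sup>k\<close>. The bad sets from \<open>m\<close>
on have total measure at most \<open>2 2\<^sup>-\<^sup>m\<close>, and outside their union the \<open>k\<close>-th error is below \<open>2\<^sup>-\<^sup>k\<close> for
all \<open>k \<ge> m\<close>. Any rates \<open>a > b > 1\<close> in place of 8 and 4 would do.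
\<close>

proposition almost_uniform_limit_if_square_integrals_small:
  assumes L2: "\<And>k. (\<lambda>x. f k x - g x) \<in> L2_space M"
    and small: "\<And>k. (\<integral>x. (f k x - g x)\<^sup>2 \<partial>M) < (1/8) ^ k"
  shows "almost_uniform_limit M f g"
  unfolding almost_uniform_limit_def
proof (intro allI impI)
  define B where "B k = {x \<in> space M. (f k x - g x)\<^sup>2 \<ge> (1/4) ^ k}" for k
  have int: "integrable M (\<lambda>x. (f k x - g x)\<^sup>2)" for k
    using L2[of k] by (simp add: L2_space_def)
  have B_sets: "B k \<in> sets M" for k
    using borel_measurable_integrable[OF int[of k]] by (simp add: B_def borel_measurable_iff_ge)
  have B_small: "emeasure M (B k) \<le> ennreal ((1/2) ^ k)" for k
  proof -
    have "emeasure M (B k) \<le> ennreal (1 / (1/4) ^ k * (\<integral>x. (f k x - g x)\<^sup>2 \<partial>M))"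
      unfolding B_def by (intro integral_Markov_inequality int[of k]) auto
    also have "\<dots> \<le> ennreal (1 / (1/4) ^ k * (1/8) ^ k)"
      using small[of k] by (intro ennreal_leI mult_left_mono) (auto simp: less_imp_le)
    also have "1 / (1/4) ^ k * (1/8) ^ k = ((1/2) ^ k :: real)"
      using power_mult_distrib[of "4 :: real" 2 k] by (simp add: power_one_over)
    finally show ?thesis .
  qed
  fix e :: real
  assume e: "e > 0"
  obtain m where "(1/2) ^ m < e / 2"
    using real_arch_pow_inv[of "e / 2" "1/2"] e by auto
  then have m: "2 * (1/2) ^ m < e"
    by simp
  define A where "A = (\<Union>k. B (k + m))"
  have A_sets: "A \<in> sets M"
    unfolding A_def using B_sets by blast
  have sums: "(\<lambda>k. (1/2) ^ (k + m) :: real) sums (2 * (1/2) ^ m)"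
  proof -
    have "(\<lambda>k. (1/2) ^ k * (1/2) ^ m :: real) sums (1 / (1 - 1/2) * (1/2) ^ m)"
      by (intro sums_mult2 geometric_sums) simp
    moreover have "1 / (1 - 1/2) = (2 :: real)"
      by simp
    ultimately show ?thesis
      by (simp only: power_add)
  qed
  have "emeasure M A \<le> suminf (\<lambda>k. emeasure M (B (k + m)))"
    unfolding A_def using B_sets by (intro emeasure_subadditive_countably) auto
  also have "\<dots> \<le> suminf (\<lambda>k. ennreal ((1/2) ^ (k + m)))"
    by (intro suminf_le B_small) auto
  also have "\<dots> = ennreal (2 * (1/2) ^ m)"
    by (intro suminf_ennreal_eq sums) simp
  also have "\<dots> < ennreal e"
    using m e by (simp add: ennreal_lessI)
  finally have A_small: "emeasure M A < ennreal e" .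
  have "uniform_limit (space M - A) f g sequentially"
    unfolding uniform_limit_iff
  proof (intro allI impI)
    fix d :: real
    assume d: "d > 0"
    have "(\<lambda>k. (1/2) ^ k :: real) \<longlonglongrightarrow> 0"
      by (intro LIMSEQ_power_zero) auto
    then have "eventually (\<lambda>k. (1/2) ^ k < d) sequentially"
      using d by (rule order_tendstoD(2))
    then show "\<forall>\<^sub>F k in sequentially. \<forall>x\<in>space M - A. dist (f k x) (g x) < d"
      using eventually_ge_at_top[of m]
    proof eventually_elim
      case (elim k)
      show ?case
      proof
        fix x assume x: "x \<in> space M - A"
        have "B k \<subseteq> A"
          unfolding A_def using elim(2) by (auto intro!: exI[of _ "k - m"])
        then have "(f k x - g x)\<^sup>2 < (1/4) ^ k"
          using x by (auto simp: B_def)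
        also have "(1/4 :: real) ^ k = ((1/2) ^ k)\<^sup>2"
          using power_mult_distrib[of "1/2 :: real" "1/2" k] by (simp add: power2_eq_square)
        finally have "\<bar>f k x - g x\<bar> < (1/2) ^ k"
          using power2_less_imp_less[of "\<bar>f k x - g x\<bar>" "(1/2) ^ k"] by simp
        then show "dist (f k x) (g x) < d"
          using elim(1) by (simp add: dist_real_def)
      qed
    qed
  qed
  with A_sets A_small
  show "\<exists>A\<in>sets M. emeasure M A < ennreal e \<and> uniform_limit (space M - A) f g sequentially"
    by blast
qed

section \<open>Least-squares polynomial approximation\<close>

text \<open>
The sum of the degrees of all monomials of \<open>p\<close> serves as a degree bound; unlike a maximum it
needs no separate treatment of the zero polynomial.
\<close>

lemma rpolys_upto_cofinal:
  obtains d where "\<And>d'. d' \<ge> d \<Longrightarrow> p \<in> rpolys_upto d'"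
proof -
  let ?deg = "\<lambda>m. \<Sum>i\<in>UNIV. Poly_Mapping.lookup m i"
  have "?deg m \<le> (\<Sum>m\<in>Poly_Mapping.keys p. ?deg m)" if "m \<in> Poly_Mapping.keys p" for m
    using that by (intro member_le_sum) auto
  then have "p \<in> rpolys_upto d'" if "d' \<ge> (\<Sum>m\<in>Poly_Mapping.keys p. ?deg m)" for d'
    using that unfolding rpolys_upto_def by (auto intro: order_trans)
  then show thesis using that by blast
qed

lemma L2_norm_on_square: "(L2_norm_on M f)\<^sup>2 = (\<integral>x. (f x)\<^sup>2 \<partial>M)"
  by (simp add: L2_norm_on_def)

theorem proposition2:
  fixes \<Omega> :: "(real ^ 'n) set"
    and M :: "(real ^ 'n) measure"
    and u :: "real ^ 'n \<Rightarrow> real"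
    and ustar :: "nat \<Rightarrow> 'n rpoly"
  assumes "compact \<Omega>" and "interior \<Omega> \<noteq> {}"
    and "finite_measure M" and "sets M = sets (restrict_space borel \<Omega>)"
    and "\<exists>U. open U \<and> U \<subseteq> \<Omega> \<and> emeasure M U > 0"
    and "u \<in> L2_space M" and "AE x in M. u x \<ge> 0"
    and "\<And>d. is_arg_min (\<lambda>p. (L2_norm_on M (\<lambda>x. u x - rpoly_eval p x))\<^sup>2)
               (\<lambda>p. p \<in> rpolys_upto d) (ustar d)"
  shows "(\<lambda>d. L2_norm_on M (\<lambda>x. u x - rpoly_eval (ustar d) x)) \<longlonglongrightarrow> 0 \<and>
    (\<exists>r. strict_mono (r :: nat \<Rightarrow> nat) \<and>
       (AE x in M. (\<lambda>k. rpoly_eval (ustar (r k)) x) \<longlonglongrightarrow> u x) \<and>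
       almost_uniform_limit M (\<lambda>k. rpoly_eval (ustar (r k))) u)"
proof -
  note comp = assms(1) and fin = assms(3) and sets_M = assms(4) and u = assms(6)
    and minimal = assms(8)
  let ?J = "\<lambda>d. \<integral>x. (u x - rpoly_eval (ustar d) x)\<^sup>2 \<partial>M"
  have J_lim: "?J \<longlonglongrightarrow> 0"
  proof (rule order_tendstoI)
    show "\<forall>\<^sub>F d in sequentially. a < ?J d" if "a < 0" for a
      using that by (auto intro!: always_eventually less_le_trans[OF that] integral_nonneg_AE)
    fix e :: real
    assume "0 < e"
    then obtain p where p: "(\<integral>x. (u x - rpoly_eval p x)\<^sup>2 \<partial>M) < e"
      using rpoly_dense_in_L2[OF comp fin sets_M u] by blast
    obtain d where d: "\<And>d'. d' \<ge> d \<Longrightarrow> p \<in> rpolys_upto d'"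
      using rpolys_upto_cofinal by blast
    \<comment> \<open>From degree \<open>d\<close> on, \<open>p\<close> is a competitor of the minimizer.\<close>
    have "?J d' < e" if "d' \<ge> d" for d'
    proof -
      have "?J d' \<le> (\<integral>x. (u x - rpoly_eval p x)\<^sup>2 \<partial>M)"
        using minimal[of d'] d[OF that]
        unfolding is_arg_min_linorder L2_norm_on_square by blast
      then show ?thesis using p by linarith
    qed
    then show "\<forall>\<^sub>F d in sequentially. ?J d < e"
      by (auto simp: eventually_sequentially)
  qed
  have norm_lim: "(\<lambda>d. L2_norm_on M (\<lambda>x. u x - rpoly_eval (ustar d) x)) \<longlonglongrightarrow> 0"
    using tendsto_real_sqrt[OF J_lim] by (simp add: L2_norm_on_def)
  obtain r :: "nat \<Rightarrow> nat" where r: "strict_mono r" "\<And>k. ?J (r k) < (1/8) ^ k"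
    using fast_subsequence[OF J_lim, of "\<lambda>k. (1/8) ^ k"] by auto
  have limit: "almost_uniform_limit M (\<lambda>k. rpoly_eval (ustar (r k))) u"
  proof (rule almost_uniform_limit_if_square_integrals_small)
    show "(\<lambda>x. rpoly_eval (ustar (r k)) x - u x) \<in> L2_space M" for k
      by (intro L2_space_diff u L2_space_continuous_on_compact[OF comp fin sets_M]
          continuous_on_rpoly_eval)
    show "(\<integral>x. (rpoly_eval (ustar (r k)) x - u x)\<^sup>2 \<partial>M) < (1/8) ^ k" for k
      using r(2)[of k] by (simp add: power2_commute)
  qed
  show ?thesis
    using norm_lim r(1) limit almost_uniform_limit_imp_AE[OF limit] by blast
qed

end
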